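(* Let $2\le m\le n-1$, let $\hat B\in\mathbb{R}^{m\times n}$, let $\mathbf{b}\in\mathbb{R}^n$, and let $B=\begin{bmatrix}\hat B\\ \mathbf{b}^T\end{bmatrix}\in\mathbb{R}^{(m+1)\times n}$. (i) If $B$ has the strong inner product property, then $\hat B$ has the strong inner product property. (ii) If $\hat B$ has the strong inner product property, the rows of $B$ are linearly independent, and $\mathbf{b}$ is nowhere zero, then $B$ has the strong inner product property.
   Context: All matrices are real; $\circ$ denotes the Hadamard product. A vector is nowhere zero if all its entries are nonzero. A matrix $M\in\mathbb{R}^{k\times n}$ with $k\le n$ has the strong inner product property (SIPP) if $M$ has rank $k$ and $X=O$ is the only symmetric $k\times k$ matrix $X$ with $(XM)\circ M=O$. *)

theory Defs
  imports Complex_Main "Jordan_Normal_Form.DL_Rank"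
begin

definition hadamard_prod :: "real mat \<Rightarrow> real mat \<Rightarrow> real mat" (infixl \<open>\<circ>\<^sub>H\<close> 70) where
  "A \<circ>\<^sub>H B = mat (dim_row A) (dim_col A) (\<lambda>(i, j). A $$ (i, j) * B $$ (i, j))"

definition nowhere_zero :: "real vec \<Rightarrow> bool" where
  "nowhere_zero v \<longleftrightarrow> (\<forall>i < dim_vec v. v $ i \<noteq> 0)"

(* The library's lin_dep is a predicate on sets of vectors, so a repeated row
   has to be excluded separately. *)
definition lin_indpt_rows :: "real mat \<Rightarrow> bool" where
  "lin_indpt_rows A \<longleftrightarrow>
     distinct (rows A) \<and>
     \<not> module.lin_dep class_ring (module_vec TYPE(real) (dim_col A)) (set (rows A))"

(* The dimension argument of vec_space.rank is the length of the columns. *)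
definition SIPP :: "real mat \<Rightarrow> bool" where
  "SIPP M \<longleftrightarrow>
     dim_row M \<le> dim_col M \<and>
     vec_space.rank (dim_row M) M = dim_row M \<and>
     (\<forall>X \<in> carrier_mat (dim_row M) (dim_row M).
        transpose_mat X = X \<and> (X * M) \<circ>\<^sub>H M = 0\<^sub>m (dim_row M) (dim_col M) \<longrightarrow>
        X = 0\<^sub>m (dim_row M) (dim_row M))"

end

theory Submission
  imports Defs
begin

text \<open>
  A matrix has full row rank iff its left kernel is trivial, so SIPP only speaks about vectors \<open>f\<close>
  and symmetric matrices \<open>X\<close> acting from the left. For (i), vectors and symmetric matrices for
  \<open>B_hat\<close> are extended by zero. For (ii), the last row of \<open>(X B) \<circ> B = O\<close> says that the last row
  of \<open>X\<close> lies in the left kernel of \<open>B\<close>, because \<open>b\<close> is nowhere zero; hence it vanishes, and by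
  symmetry so does the last column, which leaves a symmetric matrix for \<open>B_hat\<close>.
\<close>

lemma (in vec_space) scalar_prod_lincomb:
  assumes "finite S" "S \<subseteq> carrier_vec n" "v \<in> carrier_vec n"
  shows "lincomb a S \<bullet> v = (\<Sum>w\<in>S. a w * (w \<bullet> v))"
proof -
  have "lincomb a S \<bullet> v = (\<Sum>i<n. \<Sum>w\<in>S. a w * (w $ i * v $ i))"
    using assms(3) by (auto simp: scalar_prod_def atLeast0LessThan lincomb_index[OF _ assms(2)]
        sum_distrib_right mult.assoc intro!: sum.cong)
  also have "\<dots> = (\<Sum>w\<in>S. \<Sum>i<n. a w * (w $ i * v $ i))"
    by (rule sum.swap)
  also have "\<dots> = (\<Sum>w\<in>S. a w * (w \<bullet> v))"
    using assms(3) by (auto simp: scalar_prod_def atLeast0LessThan sum_distrib_left)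
  finally show ?thesis .
qed

text \<open>The field is arbitrary, so orthogonal complements with respect to a positive definite
  form cannot be invoked. Instead \<open>v\<close> is a kernel vector of a singular square matrix
  having the vectors of \<open>ws\<close> among its rows.\<close>

lemma (in vec_space) ex_orthogonal_vec:
  fixes ws :: "'a vec list"
  assumes "set ws \<subseteq> carrier_vec n" "length ws < n"
  obtains v where "v \<in> carrier_vec n" "v \<noteq> 0\<^sub>v n" "\<And>w. w \<in> set ws \<Longrightarrow> w \<bullet> v = 0"
proof -
  \<comment> \<open>Padding with zero rows makes the matrix square and singular.\<close>
  define us where "us = ws @ replicate (n - length ws) (0\<^sub>v n)"
  have len: "length us = n" and us: "set us \<subseteq> carrier_vec n"
    using assms by (auto simp: us_def)
  define C where "C = mat_of_rows n us"
  have C: "C \<in> carrier_mat n n" using len by (auto simp: C_def)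
  have "row C (n - 1) = 0\<^sub>v n"
  proof -
    have "us ! (n - 1) = 0\<^sub>v n" using assms(2) unfolding us_def by (subst nth_append_right) auto
    thus ?thesis using assms(2) len unfolding C_def by (subst mat_of_rows_row) auto
  qed
  hence "C $$ (n - 1, j) = 0" if "j < n" for j
    using C assms(2) that index_row(1)[of "n - 1" C j] by simp
  \<comment> \<open>The transpose sends the last unit vector to the last row of \<open>C\<close>,
    which is zero, so singularity is read off from a kernel vector of the transpose.\<close>
  hence "C\<^sup>T *\<^sub>v unit_vec n (n - 1) = 0\<^sub>v n"
    using C assms(2) by (intro eq_vecI) auto
  moreover have "unit_vec n (n - 1) \<noteq> (0\<^sub>v n :: 'a vec)"
    using assms(2) by (simp add: unit_vec_nonzero)
  ultimately have "det C\<^sup>T = 0"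
    using det_0_iff_vec_prod_zero_field[of "C\<^sup>T" n] C unit_vec_carrier transpose_carrier_mat by blast
  hence "det C = 0" using det_transpose[OF C] by simp
  then obtain v where v: "v \<in> carrier_vec n" "v \<noteq> 0\<^sub>v n" "C *\<^sub>v v = 0\<^sub>v n"
    using det_0_iff_vec_prod_zero_field[OF C] by auto
  have "w \<bullet> v = 0" if w: "w \<in> set ws" for w
  proof -
    from w obtain i where i: "i < length ws" "w = ws ! i" by (metis in_set_conv_nth)
    have "us ! i = w" using i by (simp add: us_def nth_append)
    hence "row C i = w" using i assms us len w unfolding C_def by (subst mat_of_rows_row) auto
    moreover have "(C *\<^sub>v v) $ i = 0" using v i assms by auto
    ultimately show ?thesis using i assms C by auto
  qed
  with v that show ?thesis by blast
qed

text \<open>Take a maximal independent set \<open>S\<close> of columns, of size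
  \<open>rank A\<close>. If it has \<open>n\<close> elements, they form an invertible matrix, whose
  transpose kills only zero. If it has fewer, some nonzero \<open>v\<close> is orthogonal to
  \<open>S\<close>, hence to its span, which contains all columns.\<close>

lemma (in vec_space) rank_eq_dim_row_iff:
  assumes A: "A \<in> carrier_mat n nc"
  shows "rank A = n \<longleftrightarrow> (\<forall>v\<in>carrier_vec n. (\<forall>c\<in>set (cols A). c \<bullet> v = 0) \<longrightarrow> v = 0\<^sub>v n)"
proof -
  have cA: "set (cols A) \<subseteq> carrier_vec n" using A cols_dim by blast
  have li0: "lin_indpt {}" by (simp add: lin_dep_def)
  then obtain S where S: "maximal S (\<lambda>T. T \<subseteq> set (cols A) \<and> lin_indpt T)" "finite S"
    using maximal_exists_superset[of "set (cols A)" "\<lambda>T. T \<subseteq> set (cols A) \<and> lin_indpt T" "{}"]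
    by auto
  have rank: "rank A = card S" by (rule rank_card_indpt[OF A S(1)])
  have SA: "S \<subseteq> set (cols A)" and li: "lin_indpt S" using S(1) by (auto simp: maximal_def)
  have Sc: "S \<subseteq> carrier_vec n" using SA cA by blast
  obtain ws where ws: "set ws = S" "distinct ws" using S(2) finite_distinct_list by blast
  have len: "length ws = card S" using ws distinct_card by fastforce
  show ?thesis
  proof (intro iffI ballI impI)
    fix v assume r: "rank A = n" and v: "v \<in> carrier_vec n" and 0: "\<forall>c\<in>set (cols A). c \<bullet> v = 0"
    define C where "C = mat_of_cols n ws"
    have C: "C \<in> carrier_mat n n" using len r rank by (auto simp: C_def)
    have cols: "cols C = ws" using ws Sc by (auto simp: C_def)
    have "rank C = n" by (rule lin_indpt_full_rank[OF C]) (use cols ws li in auto)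
    hence "det C\<^sup>T \<noteq> 0" using det_rank_iff[OF C] det_transpose[OF C] by simp
    moreover have "C\<^sup>T *\<^sub>v v = 0\<^sub>v n"
    proof (rule eq_vecI)
      fix i assume "i < dim_vec (0\<^sub>v n :: 'a vec)"
      hence i: "i < n" by simp
      have "col C i \<in> set (cols C)" using i C by (auto simp: cols_def)
      thus "(C\<^sup>T *\<^sub>v v) $ i = 0\<^sub>v n $ i" using i C 0 SA cols ws by auto
    qed (use C in auto)
    ultimately show "v = 0\<^sub>v n"
      using det_0_iff_vec_prod_zero_field[of "C\<^sup>T" n] C v by auto
  next
    assume ker: "\<forall>v\<in>carrier_vec n. (\<forall>c\<in>set (cols A). c \<bullet> v = 0) \<longrightarrow> v = 0\<^sub>v n"
    show "rank A = n"
    proof (rule ccontr)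
      assume "rank A \<noteq> n"
      moreover have "card S \<le> n" using li_le_dim(2)[OF _ _ li] Sc dim_is_n by auto
      ultimately have "length ws < n" using len rank by simp
      then obtain v where v: "v \<in> carrier_vec n" "v \<noteq> 0\<^sub>v n" "\<And>w. w \<in> S \<Longrightarrow> w \<bullet> v = 0"
        using ex_orthogonal_vec[of ws] Sc ws by auto
      have "c \<bullet> v = 0" if c: "c \<in> set (cols A)" for c
      proof (cases "c \<in> S")
        case False
        \<comment> \<open>Maximality of \<open>S\<close> puts every further column into its span, so
          orthogonality to \<open>S\<close> passes to that column by linearity.\<close>
        have "lin_dep (S \<union> {c})"
          using S(1) SA c False unfolding maximal_def by blast
        hence "c \<in> span S" using lin_dep_iff_in_span[of S c] Sc li cA c False by auto
        then obtain a T where T: "c = lincomb a T" "finite T" "T \<subseteq> S"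
          unfolding span_def by auto
        have "c \<bullet> v = (\<Sum>w\<in>T. a w * (w \<bullet> v))"
          unfolding T(1) by (rule scalar_prod_lincomb) (use T Sc v in auto)
        also have "\<dots> = 0" using v(3) T(3) by (auto intro!: sum.neutral)
        finally show ?thesis .
      qed (use v in auto)
      with ker v show False by auto
    qed
  qed
qed

text \<open>Vectors and matrices become functions on indices, of which only the values below
  \<open>k\<close> and \<open>n\<close> matter. Extending by zero and restricting then need no
  dimension bookkeeping.\<close>

definition trivial_left_kernel :: "nat \<Rightarrow> nat \<Rightarrow> (nat \<Rightarrow> nat \<Rightarrow> real) \<Rightarrow> bool" where
  "trivial_left_kernel k n M \<longleftrightarrow>
     (\<forall>f. (\<forall>j<n. (\<Sum>i<k. f i * M i j) = 0) \<longrightarrow> (\<forall>i<k. f i = 0))"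

lemma trivial_left_kernel_iff_rank:
  assumes M: "M \<in> carrier_mat k n"
  shows "vec_space.rank k M = k \<longleftrightarrow> trivial_left_kernel k n (\<lambda>i j. M $$ (i, j))"
proof -
  have sp: "col M j \<bullet> v = (\<Sum>i<k. v $ i * M $$ (i, j))" if "v \<in> carrier_vec k" "j < n" for v j
    using that M by (auto simp: scalar_prod_def atLeast0LessThan mult.commute intro!: sum.cong)
  have cols: "(\<forall>c\<in>set (cols M). P c) \<longleftrightarrow> (\<forall>j<n. P (col M j))" for P
    using M by (auto simp: cols_def)
  have "vec_space.rank k M = k \<longleftrightarrow>
      (\<forall>v\<in>carrier_vec k. (\<forall>j<n. (\<Sum>i<k. v $ i * M $$ (i, j)) = 0) \<longrightarrow> v = 0\<^sub>v k)"
    using vec_space.rank_eq_dim_row_iff[OF M] by (simp add: cols sp)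
  also have "\<dots> \<longleftrightarrow> trivial_left_kernel k n (\<lambda>i j. M $$ (i, j))"
    unfolding trivial_left_kernel_def
  \<comment> \<open>What remains is the passage between functions and vectors, via
    \<open>vec k f\<close> and \<open>\<lambda>i. v $ i\<close>.\<close>
  proof (intro iffI allI impI ballI)
    fix f i
    assume 1: "\<forall>v\<in>carrier_vec k. (\<forall>j<n. (\<Sum>i<k. v $ i * M $$ (i, j)) = 0) \<longrightarrow> v = 0\<^sub>v k"
      and 2: "\<forall>j<n. (\<Sum>i<k. f i * M $$ (i, j)) = 0" and i: "i < k"
    have "vec k f = 0\<^sub>v k" using 1[rule_format, of "vec k f"] 2 by simp
    thus "f i = 0" using i by (metis index_vec index_zero_vec(1))
  next
    fix v
    assume 1: "\<forall>f. (\<forall>j<n. (\<Sum>i<k. f i * M $$ (i, j)) = 0) \<longrightarrow> (\<forall>i<k. f i = 0)"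
      and v: "v \<in> carrier_vec k" and 2: "\<forall>j<n. (\<Sum>i<k. v $ i * M $$ (i, j)) = 0"
    show "v = 0\<^sub>v k" using 1[rule_format, of "\<lambda>i. v $ i"] 2 v by (intro eq_vecI) auto
  qed
  finally show ?thesis .
qed

text \<open>A nonzero left kernel vector is a linear relation among the rows, which are the columns
  of the transpose. Distinctness of the rows matters: coefficients of equal rows could cancel
  although the set of rows is independent.\<close>

lemma lin_indpt_rows_imp_trivial_left_kernel:
  assumes M: "M \<in> carrier_mat k n" and li: "lin_indpt_rows M"
  shows "trivial_left_kernel k n (\<lambda>i j. M $$ (i, j))"
  unfolding trivial_left_kernel_def
proof (intro allI impI)
  fix f i
  assume 0: "\<forall>j<n. (\<Sum>i<k. f i * M $$ (i, j)) = 0" and i: "i < k"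
  have T: "M\<^sup>T \<in> carrier_mat n k" using M by simp
  have "M\<^sup>T *\<^sub>v vec k f = 0\<^sub>v n"
  proof (rule eq_vecI)
    fix j assume "j < dim_vec (0\<^sub>v n :: real vec)"
    thus "(M\<^sup>T *\<^sub>v vec k f) $ j = 0\<^sub>v n $ j" using M 0
      by (simp add: scalar_prod_def atLeast0LessThan mult.commute)
  qed (use M in auto)
  hence "vec k f = 0\<^sub>v k"
    using vec_space.lin_depI[OF T, of "vec k f"] li M unfolding lin_indpt_rows_def by auto
  thus "f i = 0" using i by (metis index_vec index_zero_vec(1))
qed

text \<open>This is the condition on symmetric \<open>X\<close> in \<open>SIPP\<close>, read entry
  by entry, with \<open>g\<close> in the role of \<open>X\<close>.\<close>

definition only_zero_symmetric :: "nat \<Rightarrow> nat \<Rightarrow> (nat \<Rightarrow> nat \<Rightarrow> real) \<Rightarrow> bool" where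
  "only_zero_symmetric k n M \<longleftrightarrow>
     (\<forall>g. (\<forall>i<k. \<forall>l<k. g i l = g l i) \<longrightarrow>
          (\<forall>i<k. \<forall>j<n. (\<Sum>l<k. g i l * M l j) * M i j = 0) \<longrightarrow>
          (\<forall>i<k. \<forall>l<k. g i l = 0))"

lemma SIPP_iff:
  assumes M: "M \<in> carrier_mat k n"
  shows "SIPP M \<longleftrightarrow> k \<le> n \<and> trivial_left_kernel k n (\<lambda>i j. M $$ (i, j)) \<and>
           only_zero_symmetric k n (\<lambda>i j. M $$ (i, j))"
proof -
  have zero: "X * M \<circ>\<^sub>H M = 0\<^sub>m k n \<longleftrightarrow>
      (\<forall>i<k. \<forall>j<n. (\<Sum>l<k. X $$ (i, l) * M $$ (l, j)) * M $$ (i, j) = 0)"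
    if "X \<in> carrier_mat k k" for X
    using that M unfolding hadamard_prod_def mat_eq_iff
    by (auto simp: scalar_prod_def atLeast0LessThan)
  have "(\<forall>X\<in>carrier_mat k k. X\<^sup>T = X \<and> X * M \<circ>\<^sub>H M = 0\<^sub>m k n \<longrightarrow> X = 0\<^sub>m k k) \<longleftrightarrow>
      only_zero_symmetric k n (\<lambda>i j. M $$ (i, j))"
    unfolding only_zero_symmetric_def
  proof (intro iffI allI impI ballI)
    fix g i l
    assume 1: "\<forall>X\<in>carrier_mat k k. X\<^sup>T = X \<and> X * M \<circ>\<^sub>H M = 0\<^sub>m k n \<longrightarrow> X = 0\<^sub>m k k"
      and sym: "\<forall>i<k. \<forall>l<k. g i l = g l i"
      and 0: "\<forall>i<k. \<forall>j<n. (\<Sum>l<k. g i l * M $$ (l, j)) * M $$ (i, j) = 0"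
      and il: "i < k" "l < k"
    define X where "X = mat k k (\<lambda>(i, l). g i l)"
    have X: "X \<in> carrier_mat k k" by (simp add: X_def)
    have "X\<^sup>T = X" using sym by (auto simp: X_def mat_eq_iff)
    moreover have "X * M \<circ>\<^sub>H M = 0\<^sub>m k n" using 0 unfolding zero[OF X] by (simp add: X_def)
    ultimately have "X = 0\<^sub>m k k" using 1 X by blast
    hence "X $$ (i, l) = 0" using il by simp
    thus "g i l = 0" using il by (simp add: X_def)
  next
    fix X
    assume 1: "\<forall>g. (\<forall>i<k. \<forall>l<k. g i l = g l i) \<longrightarrow>
          (\<forall>i<k. \<forall>j<n. (\<Sum>l<k. g i l * M $$ (l, j)) * M $$ (i, j) = 0) \<longrightarrow>
          (\<forall>i<k. \<forall>l<k. g i l = 0)"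
      and X: "X \<in> carrier_mat k k" and 2: "X\<^sup>T = X \<and> X * M \<circ>\<^sub>H M = 0\<^sub>m k n"
    have "\<forall>i<k. \<forall>l<k. X $$ (i, l) = X $$ (l, i)"
      using 2 X by (metis carrier_matD index_transpose_mat(1))
    moreover have "\<forall>i<k. \<forall>j<n. (\<Sum>l<k. X $$ (i, l) * M $$ (l, j)) * M $$ (i, j) = 0"
      using 2 zero[OF X] by blast
    ultimately have "\<forall>i<k. \<forall>l<k. X $$ (i, l) = 0"
      using 1[THEN spec, of "\<lambda>i l. X $$ (i, l)"] by blast
    thus "X = 0\<^sub>m k k"
      using X by (auto simp: mat_eq_iff)
  qed
  thus ?thesis using M trivial_left_kernel_iff_rank[OF M] by (simp add: SIPP_def)
qed

theorem proposition3p9: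
  fixes m n :: nat and B_hat B :: "real mat" and b :: "real vec"
  assumes "2 \<le> m" and "m \<le> n - 1"
    and "B_hat \<in> carrier_mat m n"
    and "b \<in> carrier_vec n"
    and "B = B_hat @\<^sub>r mat_of_row b"
  shows "(SIPP B \<longrightarrow> SIPP B_hat) \<and>
         (SIPP B_hat \<and> lin_indpt_rows B \<and> nowhere_zero b \<longrightarrow> SIPP B)"
proof (intro conjI impI)
  have B: "B \<in> carrier_mat (Suc m) n"
    using assms(3-5) carrier_append_rows[of B_hat m n "mat_of_row b" 1] by simp
  have upper: "B $$ (i, j) = B_hat $$ (i, j)" if "i < m" "j < n" for i j
    using assms(3-5) that by (simp add: append_rows_def)
  have last: "B $$ (m, j) = b $ j" if "j < n" for j
    using assms(3-5) that by (simp add: append_rows_def mat_of_row_def)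
  \<comment> \<open>Both directions compare \<open>B\<close> with \<open>B_hat\<close> through this
    formula: the extra term \<open>f m * b $ j\<close> disappears as soon as the coefficient
    \<open>f m\<close> is zero.\<close>
  have split_last: "(\<Sum>i<Suc m. f i * B $$ (i, j)) = (\<Sum>i<m. f i * B_hat $$ (i, j)) + f m * b $ j"
    if "j < n" for f j
    using that by (simp add: upper last)
  {
    assume "SIPP B"
    hence ker: "trivial_left_kernel (Suc m) n (\<lambda>i j. B $$ (i, j))"
      and sym: "only_zero_symmetric (Suc m) n (\<lambda>i j. B $$ (i, j))"
      unfolding SIPP_iff[OF B] by auto
    have "trivial_left_kernel m n (\<lambda>i j. B_hat $$ (i, j))"
      unfolding trivial_left_kernel_def
    proof (intro allI impI)
      fix f i
      assume 0: "\<forall>j<n. (\<Sum>i<m. f i * B_hat $$ (i, j)) = 0" and i: "i < m"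
      define f' where "f' i = (if i < m then f i else 0)" for i
      have "(\<Sum>i<Suc m. f' i * B $$ (i, j)) = 0" if "j < n" for j
        using 0 that unfolding split_last[OF that] by (simp add: f'_def)
      hence "f' i = 0" using ker i unfolding trivial_left_kernel_def by (meson less_Suc_eq)
      thus "f i = 0" using i by (simp add: f'_def)
    qed
    moreover have "only_zero_symmetric m n (\<lambda>i j. B_hat $$ (i, j))"
      unfolding only_zero_symmetric_def
    proof (intro allI impI)
      fix g i l
      assume gs: "\<forall>i<m. \<forall>l<m. g i l = g l i"
        and 0: "\<forall>i<m. \<forall>j<n. (\<Sum>l<m. g i l * B_hat $$ (l, j)) * B_hat $$ (i, j) = 0"
        and il: "i < m" "l < m"
      \<comment> \<open>Bordering \<open>g\<close> with a zero row and column keeps it symmetric.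
        The new row satisfies its equations trivially, and in the old rows the zero in column
        \<open>m\<close> removes the contribution of \<open>b\<close>.\<close>
      define g' where "g' i l = (if i < m \<and> l < m then g i l else 0)" for i l
      have gs': "\<forall>i<Suc m. \<forall>l<Suc m. g' i l = g' l i" using gs by (auto simp: g'_def)
      have zero: "(\<Sum>l<Suc m. g' i l * B $$ (l, j)) * B $$ (i, j) = 0"
        if "i < Suc m" "j < n" for i j
        using 0 that unfolding split_last[OF that(2)]
        by (cases "i = m") (simp_all add: g'_def upper)
      have "\<forall>i<Suc m. \<forall>l<Suc m. g' i l = 0"
        using sym[unfolded only_zero_symmetric_def, THEN spec, of g'] gs' zero by blast
      hence "g' i l = 0" using il by simp
      thus "g i l = 0" using il by (simp add: g'_def)
    qed
    ultimately show "SIPP B_hat"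
      using assms(2) unfolding SIPP_iff[OF assms(3)] by simp
  }
  {
    assume h: "SIPP B_hat \<and> lin_indpt_rows B \<and> nowhere_zero b"
    \<comment> \<open>Independence of the rows serves twice: it gives the rank of \<open>B\<close>,
      and it kills the last row of the symmetric matrix below.\<close>
    have ker: "trivial_left_kernel (Suc m) n (\<lambda>i j. B $$ (i, j))"
      using lin_indpt_rows_imp_trivial_left_kernel[OF B] h by blast
    have sym: "only_zero_symmetric m n (\<lambda>i j. B_hat $$ (i, j))"
      using h unfolding SIPP_iff[OF assms(3)] by blast
    have "only_zero_symmetric (Suc m) n (\<lambda>i j. B $$ (i, j))"
      unfolding only_zero_symmetric_def
    proof (intro allI impI)
      fix g i l
      assume gs: "\<forall>i<Suc m. \<forall>l<Suc m. g i l = g l i"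
        and 0: "\<forall>i<Suc m. \<forall>j<n. (\<Sum>l<Suc m. g i l * B $$ (l, j)) * B $$ (i, j) = 0"
        and il: "i < Suc m" "l < Suc m"
      \<comment> \<open>In row \<open>m\<close> the Hadamard factor is \<open>b $ j\<close>, which
        is nonzero and can be cancelled.\<close>
      have "(\<Sum>l<Suc m. g m l * B $$ (l, j)) = 0" if "j < n" for j
        using 0[rule_format, of m j] that h assms(4) last[OF that] by (auto simp: nowhere_zero_def)
      hence row: "g m l = 0" if "l < Suc m" for l
        using ker that unfolding trivial_left_kernel_def by blast
      hence col: "g l m = 0" if "l < Suc m" for l
        using gs that by (metis lessI)
      \<comment> \<open>Since \<open>g i m = 0\<close>, the upper rows of the equation for
        \<open>B\<close> reduce to the equation for \<open>B_hat\<close>.\<close>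
      have "(\<Sum>l<m. g i l * B_hat $$ (l, j)) * B_hat $$ (i, j) = 0" if "i < m" "j < n" for i j
      proof -
        have "(\<Sum>l<Suc m. g i l * B $$ (l, j)) * B $$ (i, j) = 0" using 0 that by simp
        thus ?thesis using that col[of i] unfolding split_last[OF that(2)] by (simp add: upper)
      qed
      moreover have "\<forall>i<m. \<forall>l<m. g i l = g l i" using gs by simp
      ultimately have "\<forall>i<m. \<forall>l<m. g i l = 0"
        using sym unfolding only_zero_symmetric_def by blast
      thus "g i l = 0" using row col il by (auto simp: less_Suc_eq)
    qed
    \<comment> \<open>The shape condition is \<open>Suc m \<le> n\<close>. With truncated
      subtraction, \<open>m \<le> n - 1\<close> yields it only because \<open>2 \<le> m\<close>
      excludes \<open>m = n = 0\<close>.\<close>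
    thus "SIPP B" using ker assms(1,2) unfolding SIPP_iff[OF B] by simp
  }
qed

end
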